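(* Let $m\ge1$, let $h$ be a positive integer, let $\lambda$ be a partition with at most $m$ parts and let $\mathbf{x}=(x_1,\ldots,x_m)$. Then the Newton polytope $\mathrm{Newt}(G_{h,\lambda}(\mathbf{x}))$ has the integer decomposition property.
   Context: $\mathrm{Newt}(f)$ is the convex hull of exponent vectors of monomials with nonzero coefficient in $f$. The Schur polynomial $s_\mu(x_1,\ldots,x_m)=\sum_T\mathbf{x}^T$ over semistandard Young tableaux $T$ of shape $\mu$ with entries in $\{1,\ldots,m\}$. For a partition $\mu\supseteq\lambda$ with at most $m$ rows, $b_{h,\lambda\mu}$ is the number of fillings of the skew shape $\mu/\lambda$ with positive integers strictly increasing along each row and column, entries in row $r$ from $\{1,\ldots,h(r-1)\}$; $A(h,\lambda)=\{\mu\mid b_{h,\lambda\mu}\neq0\}$; $G_{h,\lambda}(\mathbf{x})=\sum_{\mu\in A(h,\lambda)}(-1)^{|\mu/\lambda|}b_{h,\lambda\mu}s_\mu(\mathbf{x})$. A lattice polytope $\mathcal{P}\subset\mathbb{R}^m$ has the integer decomposition property (IDP) if for every positive integer $t$ and every $\mathbf{p}\in t\mathcal{P}\cap\mathbb{Z}^m$ there exist $\mathbf{v}_1,\ldots,\mathbf{v}_t\in\mathcal{P}\cap\mathbb{Z}^m$ with $\mathbf{p}=\mathbf{v}_1+\cdots+\mathbf{v}_t$. *)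

theory Defs
  imports "HOL-Analysis.Analysis" "HOL-Library.Poly_Mapping" "HOL-Library.FuncSet"
begin

text \<open>
  Conventions. The ambient space is \<open>real ^ 'm\<close> for a finite linearly ordered index type \<open>'m\<close>,
  so that \<open>m = CARD('m)\<close> (in particular \<open>m \<ge> 1\<close>) and the elements of \<open>'m\<close>, in increasing order,
  play the role of \<open>1, \<dots>, m\<close>. Rows and columns of diagrams are numbered from \<open>0\<close>.
\<close>

section \<open>Polynomials and Newton polytopes\<close>

type_synonym 'm mpoly = "('m \<Rightarrow>\<^sub>0 nat) \<Rightarrow>\<^sub>0 int"

definition var :: "'m \<Rightarrow> 'm mpoly" where
  "var k = Poly_Mapping.single (Poly_Mapping.single k 1) 1"

definition exponent_vector :: "('m::finite \<Rightarrow>\<^sub>0 nat) \<Rightarrow> real ^ 'm" where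
  "exponent_vector e = (\<chi> k. real (Poly_Mapping.lookup e k))"

definition Newt :: "'m::finite mpoly \<Rightarrow> (real ^ 'm) set" where
  "Newt p = convex hull (exponent_vector ` Poly_Mapping.keys p)"

section \<open>Integer decomposition property\<close>

definition lattice_points :: "(real ^ 'm) set" where
  "lattice_points = {x. \<forall>k. x $ k \<in> \<int>}"

definition lattice_polytope :: "(real ^ 'm::finite) set \<Rightarrow> bool" where
  "lattice_polytope P \<longleftrightarrow> (\<exists>V. finite V \<and> V \<subseteq> lattice_points \<and> P = convex hull V)"

definition has_IDP :: "(real ^ 'm::finite) set \<Rightarrow> bool" where
  "has_IDP P \<longleftrightarrow> lattice_polytope P \<and>
     (\<forall>t::nat. t \<ge> 1 \<longrightarrow>
       (\<forall>p \<in> (\<lambda>x. real t *\<^sub>R x) ` P \<inter> lattice_points.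
         \<exists>v :: nat \<Rightarrow> real ^ 'm. (\<forall>i\<in>{1..t}. v i \<in> P \<inter> lattice_points) \<and> p = (\<Sum>i=1..t. v i)))"

section \<open>Partitions, tableaux and Schur polynomials\<close>

text \<open>A partition is the sequence of its parts, padded with zeros.\<close>

definition partition_at_most :: "nat \<Rightarrow> (nat \<Rightarrow> nat) \<Rightarrow> bool" where
  "partition_at_most m \<mu> \<longleftrightarrow> antimono \<mu> \<and> (\<forall>i\<ge>m. \<mu> i = 0)"

definition skew_cells :: "(nat \<Rightarrow> nat) \<Rightarrow> (nat \<Rightarrow> nat) \<Rightarrow> (nat \<times> nat) set" where
  "skew_cells \<mu> lam = {(i, j). lam i \<le> j \<and> j < \<mu> i}"

abbreviation cells :: "(nat \<Rightarrow> nat) \<Rightarrow> (nat \<times> nat) set" where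
  "cells \<mu> \<equiv> skew_cells \<mu> (\<lambda>_. 0)"

text \<open>
  Fillings are extensional functions on the cells of the diagram (via \<open>\<rightarrow>\<^sub>E\<close>), so that
  distinct functions are distinct fillings.
\<close>

definition ssyt :: "(nat \<Rightarrow> nat) \<Rightarrow> (nat \<times> nat \<Rightarrow> 'm::linorder) set" where
  "ssyt \<mu> = {T \<in> cells \<mu> \<rightarrow>\<^sub>E UNIV.
     (\<forall>i j j'. (i, j) \<in> cells \<mu> \<longrightarrow> (i, j') \<in> cells \<mu> \<longrightarrow> j < j' \<longrightarrow> T (i, j) \<le> T (i, j')) \<and>
     (\<forall>i i' j. (i, j) \<in> cells \<mu> \<longrightarrow> (i', j) \<in> cells \<mu> \<longrightarrow> i < i' \<longrightarrow> T (i, j) < T (i', j))}"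

definition schur :: "(nat \<Rightarrow> nat) \<Rightarrow> 'm::{finite,linorder} mpoly" where
  "schur \<mu> = (\<Sum>T\<in>ssyt \<mu>. \<Prod>c\<in>cells \<mu>. var (T c))"

section \<open>The polynomials \<open>G\<close>\<close>

text \<open>
  Row \<open>i\<close> below is row \<open>r = i + 1\<close> in the usual numbering, so the bound
  \<open>h * i\<close> on its entries is \<open>h * (r - 1)\<close>.
\<close>

definition flagged_fillings ::
    "nat \<Rightarrow> (nat \<Rightarrow> nat) \<Rightarrow> (nat \<Rightarrow> nat) \<Rightarrow> (nat \<times> nat \<Rightarrow> nat) set" where
  "flagged_fillings h lam \<mu> = {F \<in> (\<Pi>\<^sub>E (i, j) \<in> skew_cells \<mu> lam. {1..h * i}).
     (\<forall>i j j'. (i, j) \<in> skew_cells \<mu> lam \<longrightarrow> (i, j') \<in> skew_cells \<mu> lam \<longrightarrow> j < j'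
        \<longrightarrow> F (i, j) < F (i, j')) \<and>
     (\<forall>i i' j. (i, j) \<in> skew_cells \<mu> lam \<longrightarrow> (i', j) \<in> skew_cells \<mu> lam \<longrightarrow> i < i'
        \<longrightarrow> F (i, j) < F (i', j))}"

definition b_coeff :: "nat \<Rightarrow> (nat \<Rightarrow> nat) \<Rightarrow> (nat \<Rightarrow> nat) \<Rightarrow> nat" where
  "b_coeff h lam \<mu> = card (flagged_fillings h lam \<mu>)"

definition A_set :: "nat \<Rightarrow> nat \<Rightarrow> (nat \<Rightarrow> nat) \<Rightarrow> (nat \<Rightarrow> nat) set" where
  "A_set m h lam = {\<mu>. partition_at_most m \<mu> \<and> lam \<le> \<mu> \<and> b_coeff h lam \<mu> \<noteq> 0}"

definition G_poly :: "nat \<Rightarrow> (nat \<Rightarrow> nat) \<Rightarrow> 'm::{finite,linorder} mpoly" where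
  "G_poly h lam = (\<Sum>\<mu>\<in>A_set CARD('m) h lam.
     (- 1) ^ card (skew_cells \<mu> lam) * of_nat (b_coeff h lam \<mu>) * schur \<mu>)"

section \<open>Finiteness\<close>

text \<open>The index sets of the sums and the sets whose cardinalities are taken above are finite.\<close>

lemma finite_skew_cells:
  assumes "partition_at_most m \<mu>"
  shows "finite (skew_cells \<mu> lam)"
proof -
  have "skew_cells \<mu> lam \<subseteq> {..<m} \<times> {..<\<mu> 0}"
  proof
    fix c assume "c \<in> skew_cells \<mu> lam"
    then obtain i j where c: "c = (i, j)" "j < \<mu> i"
      by (auto simp: skew_cells_def)
    have "i < m"
      using assms c(2) by (metis not_less partition_at_most_def not_less0)
    moreover have "\<mu> i \<le> \<mu> 0"
      using assms by (simp add: partition_at_most_def antimono_def)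
    ultimately show "c \<in> {..<m} \<times> {..<\<mu> 0}"
      using c by auto
  qed
  then show ?thesis
    using finite_subset by blast
qed

lemma finite_ssyt:
  assumes "partition_at_most m \<mu>"
  shows "finite (ssyt \<mu> :: (nat \<times> nat \<Rightarrow> 'm::{finite,linorder}) set)"
proof -
  have "finite (cells \<mu> \<rightarrow>\<^sub>E (UNIV :: 'm set))"
    by (intro finite_PiE finite_skew_cells[OF assms]) auto
  then show ?thesis
    by (simp add: ssyt_def)
qed

lemma finite_flagged_fillings:
  assumes "partition_at_most m \<mu>"
  shows "finite (flagged_fillings h lam \<mu>)"
proof -
  have "finite (\<Pi>\<^sub>E (i, j) \<in> skew_cells \<mu> lam. {1..h * i})"
    by (intro finite_PiE finite_skew_cells[OF assms]) auto
  then show ?thesis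
    by (simp add: flagged_fillings_def)
qed

lemma finite_A_set: "finite (A_set m h lam)"
proof -
  have "\<mu> i \<le> lam 0 \<and> (m \<le> i \<longrightarrow> \<mu> i = 0)" if \<mu>: "\<mu> \<in> A_set m h lam" for \<mu> i
  proof -
    have p: "partition_at_most m \<mu>" and "b_coeff h lam \<mu> \<noteq> 0"
      using \<mu> by (auto simp: A_set_def)
    then obtain F where F: "F \<in> flagged_fillings h lam \<mu>"
      by (metis all_not_in_conv b_coeff_def card.empty)
    have "\<mu> 0 \<le> lam 0"
    proof (rule ccontr)
      assume "\<not> \<mu> 0 \<le> lam 0"
      then have "(0, lam 0) \<in> skew_cells \<mu> lam"
        by (simp add: skew_cells_def)
      moreover have "F \<in> (\<Pi>\<^sub>E (i, j) \<in> skew_cells \<mu> lam. {1..h * i})"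
        using F by (simp add: flagged_fillings_def)
      ultimately have "F (0, lam 0) \<in> {1..h * 0}"
        by (auto dest: PiE_mem)
      then show False by simp
    qed
    moreover have "\<mu> i \<le> \<mu> 0"
      using p by (simp add: partition_at_most_def antimono_def)
    ultimately show ?thesis
      using p by (auto simp: partition_at_most_def)
  qed
  then have "A_set m h lam \<subseteq> {\<mu>. \<forall>i. (i \<in> {..<m} \<longrightarrow> \<mu> i \<in> {..lam 0}) \<and> (i \<notin> {..<m} \<longrightarrow> \<mu> i = 0)}"
    by auto
  moreover have "finite \<dots>"
    by (rule finite_set_of_finite_funs) auto
  ultimately show ?thesis
    by (rule finite_subset)
qed

end

theory Submission
  imports Defs "HOL-Combinatorics.Transposition"
begin

text \<open>
  The index set of \<open>G\<close> is the interval of partitions \<open>lam \<le> \<mu> \<le> M\<close> with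
  \<open>M r = min {lam s + h * s | s \<le> r}\<close>, and no cancellation occurs, as signs depend only on the
  degree. So the Newton polytope contains every permutation of every such \<open>\<mu>\<close>, and every point \<open>x\<close>
  of it satisfies \<open>x(I) \<le> M 0 + \<dots> + M (|I| - 1)\<close> and \<open>x(-I) \<ge> lam |I| + \<dots> + lam (m - 1)\<close>.

  These inequalities, multiplied by \<open>t\<close>, say that an integer point \<open>p\<close> of the \<open>t\<close>-th dilate is
  majorized by a vector \<open>(t M 0, \<dots>, t M (r - 1), c, t lam (r + 1), \<dots>)\<close> with
  \<open>t lam r \<le> c \<le> t M r\<close>, which visibly is a sum of \<open>t\<close> partitions of the interval. One gets from
  this vector down to \<open>p\<close> by moving single units from larger to smaller entries. In a sum of
  vectors such a move can be made inside one summand, where it does not leave a symmetric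
  convex set.
\<close>

section \<open>Unit transfers\<close>

text \<open>These are the Robin Hood transfers of majorization theory. If
  \<open>u a = u b + 1\<close>, the transfer just swaps the two values.\<close>

definition transfer_closed :: "('a \<Rightarrow> int) set \<Rightarrow> bool" where
  "transfer_closed W \<longleftrightarrow>
     (\<forall>u\<in>W. \<forall>a b. u b < u a \<longrightarrow> u(a := u a - 1, b := u b + 1) \<in> W)"

text \<open>If no summand had its value at \<open>b\<close> below its value at \<open>a\<close>,
  neither would the sum. So some summand admits the transfer, and performing it there moves the same
  unit in the sum.\<close>

lemma transfer_closed_sum:
  fixes W :: "('a \<Rightarrow> int) set"
  assumes W: "transfer_closed W" and J: "finite J"
  shows "transfer_closed {\<lambda>k. \<Sum>j\<in>J. v j k | v. \<forall>j\<in>J. v j \<in> W}"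
  unfolding transfer_closed_def
proof (intro ballI allI impI)
  fix u a b
  assume "u \<in> {\<lambda>k. \<Sum>j\<in>J. v j k | v. \<forall>j\<in>J. v j \<in> W}" and less: "u b < u a"
  then obtain v where u: "u = (\<lambda>k. \<Sum>j\<in>J. v j k)" and v: "\<forall>j\<in>J. v j \<in> W"
    by auto
  have "\<exists>j\<in>J. v j b < v j a"
  proof (rule ccontr)
    assume "\<not> ?thesis"
    then have "u a \<le> u b"
      unfolding u by (intro sum_mono) auto
    with less show False by simp
  qed
  then obtain j where j: "j \<in> J" "v j b < v j a"
    by auto
  define w where "w = v(j := (v j)(a := v j a - 1, b := v j b + 1))"
  have "\<forall>i\<in>J. w i \<in> W"
    using v j W by (auto simp: w_def transfer_closed_def)
  moreover have "u(a := u a - 1, b := u b + 1) = (\<lambda>k. \<Sum>i\<in>J. w i k)"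
  proof
    fix k
    have "(\<Sum>i\<in>J. w i k) = w j k + (\<Sum>i\<in>J - {j}. v i k)"
      using J j by (subst sum.remove[of _ j]) (auto simp: w_def intro!: sum.cong)
    moreover have "u k = v j k + (\<Sum>i\<in>J - {j}. v i k)" for k
      using J j unfolding u by (subst sum.remove[of _ j]) auto
    ultimately show "(u(a := u a - 1, b := u b + 1)) k = (\<Sum>i\<in>J. w i k)"
      by (auto simp: w_def)
  qed
  ultimately show "u(a := u a - 1, b := u b + 1) \<in> {\<lambda>k. \<Sum>j\<in>J. v j k | v. \<forall>j\<in>J. v j \<in> W}"
    by auto
qed

text \<open>
  Let \<open>b\<close> be the first position where \<open>q\<close> is smaller than \<open>p\<close>, and \<open>a < b\<close> a position where it is
  larger. Since \<open>p\<close> is decreasing, \<open>q b < p b \<le> p a < q a\<close>, so a unit may be moved from \<open>a\<close> to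
  \<open>b\<close>, and the dominance of partial sums survives.
\<close>

lemma transfer_closed_majorized:
  fixes p q :: "'a \<Rightarrow> int" and m :: nat
  assumes R: "transfer_closed R"
    and bij: "bij_betw \<sigma> {..<m} (UNIV :: 'a set)"
    and sorted: "\<And>i j. i \<le> j \<Longrightarrow> j < m \<Longrightarrow> p (\<sigma> j) \<le> p (\<sigma> i)"
    and "q \<in> R"
    and "\<And>k. k \<le> m \<Longrightarrow> (\<Sum>i<k. p (\<sigma> i)) \<le> (\<Sum>i<k. q (\<sigma> i))"
    and "(\<Sum>i<m. p (\<sigma> i)) = (\<Sum>i<m. q (\<sigma> i))"
  shows "p \<in> R"
  using assms(4-6)
\<comment> \<open>The l1 distance to \<open>p\<close> decreases: the transfer brings
  \<open>q\<close> closer by one at each of the two positions.\<close>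
proof (induction "nat (\<Sum>i<m. \<bar>q (\<sigma> i) - p (\<sigma> i)\<bar>)" arbitrary: q rule: less_induct)
  case less
  note dom = less.prems(2) and tot = less.prems(3)
  show ?case
  proof (cases "\<exists>b<m. q (\<sigma> b) < p (\<sigma> b)")
    case False
    then have "(\<Sum>i<m. q (\<sigma> i) - p (\<sigma> i)) = 0 \<longleftrightarrow> (\<forall>i\<in>{..<m}. q (\<sigma> i) - p (\<sigma> i) = 0)"
      by (intro sum_nonneg_eq_0_iff) (auto simp: not_less dest: leD)
    with tot have eq: "\<forall>i\<in>{..<m}. q (\<sigma> i) = p (\<sigma> i)"
      by (simp add: sum_subtractf)
    have "q = p"
    proof
      fix k
      have "k \<in> \<sigma> ` {..<m}"
        using bij by (simp add: bij_betw_def)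
      then show "q k = p k" using eq by auto
    qed
    with less.prems show ?thesis by simp
  next
    case True
    define b where "b = (LEAST b. b < m \<and> q (\<sigma> b) < p (\<sigma> b))"
    have b: "b < m" "q (\<sigma> b) < p (\<sigma> b)"
      using LeastI_ex[OF True] by (auto simp: b_def)
    have before: "p (\<sigma> i) \<le> q (\<sigma> i)" if "i < b" for i
      using not_less_Least[of i "\<lambda>b. b < m \<and> q (\<sigma> b) < p (\<sigma> b)"] that b
      by (auto simp: b_def[symmetric])
    have "\<exists>a<b. p (\<sigma> a) < q (\<sigma> a)"
    proof (rule ccontr)
      assume "\<not> ?thesis"
      then have "(\<Sum>i<b. q (\<sigma> i)) \<le> (\<Sum>i<b. p (\<sigma> i))"
        by (intro sum_mono) auto
      then have "(\<Sum>i<Suc b. q (\<sigma> i)) < (\<Sum>i<Suc b. p (\<sigma> i))"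
        using b by simp
      with dom[of "Suc b"] b show False by simp
    qed
    then obtain a where a: "a < b" "p (\<sigma> a) < q (\<sigma> a)"
      by auto
    have inj: "\<sigma> i = \<sigma> j \<longleftrightarrow> i = j" if "i < m" "j < m" for i j
      using bij that by (auto simp: bij_betw_def inj_on_def)
    define q' where "q' = q(\<sigma> a := q (\<sigma> a) - 1, \<sigma> b := q (\<sigma> b) + 1)"
    have q': "q' (\<sigma> i) = (if i = a then q (\<sigma> i) - 1 else if i = b then q (\<sigma> i) + 1 else q (\<sigma> i))"
      if "i < m" for i
      using that a b inj by (auto simp: q'_def)
    have "q (\<sigma> b) < q (\<sigma> a)"
      using a b sorted[of a b] by simp
    then have "q' \<in> R"
      using R less.prems(1) by (simp add: transfer_closed_def q'_def)
    have psum: "(\<Sum>i<k. q' (\<sigma> i)) =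
        (\<Sum>i<k. q (\<sigma> i)) - (if a < k then 1 else 0) + (if b < k then 1 else 0)"
      if "k \<le> m" for k
    proof -
      have "(\<Sum>i<k. q' (\<sigma> i)) =
          (\<Sum>i<k. q (\<sigma> i) - (if i = a then 1 else 0) + (if i = b then 1 else 0))"
        using that a by (intro sum.cong) (auto simp: q')
      then show ?thesis
        by (simp add: sum.distrib sum_subtractf)
    qed
    have "(\<Sum>i<k. p (\<sigma> i)) \<le> (\<Sum>i<k. q' (\<sigma> i))" if k: "k \<le> m" for k
    \<comment> \<open>Only these partial sums drop, by one. There is room: before \<open>b\<close>
      no entry of \<open>q\<close> is below that of \<open>p\<close>, and at \<open>a\<close> it is
      larger.\<close>
    proof (cases "a < k \<and> k \<le> b")
      case True
      have "(\<Sum>i<k. p (\<sigma> i)) < (\<Sum>i<k. q (\<sigma> i))"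
        using True a before by (intro sum_strict_mono_ex1) auto
      with True k show ?thesis by (simp add: psum)
    next
      case False
      with dom[OF k] a k show ?thesis by (auto simp: psum)
    qed
    moreover have "(\<Sum>i<m. p (\<sigma> i)) = (\<Sum>i<m. q' (\<sigma> i))"
      using tot a b by (simp add: psum)
    moreover have "(\<Sum>i<m. \<bar>q' (\<sigma> i) - p (\<sigma> i)\<bar>) < (\<Sum>i<m. \<bar>q (\<sigma> i) - p (\<sigma> i)\<bar>)"
      using a b by (intro sum_strict_mono_ex1) (auto simp: q' intro!: bexI[of _ a])
    then have "nat (\<Sum>i<m. \<bar>q' (\<sigma> i) - p (\<sigma> i)\<bar>) < nat (\<Sum>i<m. \<bar>q (\<sigma> i) - p (\<sigma> i)\<bar>)"
      by (subst nat_mono_iff) (auto intro: order.strict_trans1[OF sum_nonneg])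
    ultimately show ?thesis
      using less.hyps[of q'] \<open>q' \<in> R\<close> by blast
  qed
qed

lemma decreasing_enumeration:
  fixes p :: "'a::finite \<Rightarrow> int"
  obtains \<sigma> where "bij_betw \<sigma> {..<CARD('a)} (UNIV :: 'a set)"
    and "\<And>i j. i \<le> j \<Longrightarrow> j < CARD('a) \<Longrightarrow> p (\<sigma> j) \<le> p (\<sigma> i)"
proof -
  obtain xs :: "'a list" where xs: "set xs = UNIV" "distinct xs"
    using finite_distinct_list[of "UNIV :: 'a set"] by auto
  define ys where "ys = sort_key (\<lambda>k. - p k) xs"
  have ys: "set ys = UNIV" "distinct ys" "sorted (map (\<lambda>k. - p k) ys)"
    using xs by (auto simp: ys_def)
  have len: "length ys = CARD('a)"
    using ys distinct_card[of ys] by simp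
  show ?thesis
  proof (rule that[of "(!) ys"])
    show "bij_betw ((!) ys) {..<CARD('a)} UNIV"
      using bij_betw_nth[of ys "{..<CARD('a)}" UNIV] ys len by auto
    show "p (ys ! j) \<le> p (ys ! i)" if "i \<le> j" "j < CARD('a)" for i j
      using sorted_nth_mono[OF ys(3), of i j] that len by simp
  qed
qed

section \<open>Supports of Schur polynomials\<close>

text \<open>The weight of a filling, as the exponent of its monomial.\<close>

definition content :: "(nat \<times> nat \<Rightarrow> 'm) \<Rightarrow> (nat \<times> nat) set \<Rightarrow> 'm \<Rightarrow>\<^sub>0 nat" where
  "content T D = (\<Sum>c\<in>D. Poly_Mapping.single (T c) 1)"

lemma lookup_content:
  assumes "finite D"
  shows "Poly_Mapping.lookup (content T D) k = card {c\<in>D. T c = k}"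
proof -
  have "Poly_Mapping.lookup (content T D) k = (\<Sum>c\<in>D. if T c = k then 1 else 0)"
    by (simp add: content_def lookup_sum lookup_single when_def eq_commute
        flip: One_nat_def)
  also have "\<dots> = card {c\<in>D. T c = k}"
    using assms by (simp add: sum.If_cases Int_def)
  finally show ?thesis .
qed

lemma sum_lookup_content:
  assumes "finite D" "finite I"
  shows "(\<Sum>k\<in>I. Poly_Mapping.lookup (content T D) k) = card {c\<in>D. T c \<in> I}"
proof -
  have "{c\<in>D. T c \<in> I} = (\<Union>k\<in>I. {c\<in>D. T c = k})"
    by auto
  also have "card \<dots> = (\<Sum>k\<in>I. card {c\<in>D. T c = k})"
    using assms by (intro card_UN_disjoint) auto
  finally show ?thesis
    using assms by (simp add: lookup_content)
qed

lemma prod_var: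
  "finite D \<Longrightarrow> (\<Prod>c\<in>D. var (T c)) = Poly_Mapping.single (content T D) 1"
  by (induction D rule: finite_induct) (simp_all add: content_def var_def mult_single)

text \<open>The coefficients are the Kostka numbers; as counts they cannot cancel each
  other.\<close>

lemma lookup_schur:
  assumes "partition_at_most m \<mu>"
  shows "Poly_Mapping.lookup (schur \<mu> :: 'm::{finite,linorder} mpoly) e =
    int (card {T \<in> ssyt \<mu>. content T (cells \<mu>) = e})"
proof -
  have "Poly_Mapping.lookup (schur \<mu> :: 'm mpoly) e =
      (\<Sum>T\<in>ssyt \<mu>. if content T (cells \<mu>) = e then 1 else 0)"
    by (simp add: schur_def lookup_sum prod_var[OF finite_skew_cells[OF assms]] lookup_single when_def
        eq_commute)
  then show ?thesis
    using finite_ssyt[OF assms, where 'm = 'm] by (simp add: sum.If_cases Int_def)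
qed

lemma card_cells:
  assumes "partition_at_most m \<mu>"
  shows "card (cells \<mu>) = (\<Sum>i<m. \<mu> i)"
proof -
  have "cells \<mu> = (SIGMA i:{..<m}. {..<\<mu> i})"
    using assms by (auto simp: skew_cells_def partition_at_most_def) (metis not_less not_less0)
  then show ?thesis by simp
qed

lemma card_skew_cells:
  assumes "partition_at_most m \<mu>" "partition_at_most m lam" "lam \<le> \<mu>"
  shows "card (skew_cells \<mu> lam) = card (cells \<mu>) - card (cells lam)"
proof -
  have "skew_cells \<mu> lam = cells \<mu> - cells lam"
    by (auto simp: skew_cells_def)
  moreover have "cells lam \<subseteq> cells \<mu>"
    using assms(3) by (auto simp: skew_cells_def le_fun_def intro: less_le_trans)
  ultimately show ?thesis
    using finite_skew_cells[OF assms(2)] by (simp add: card_Diff_subset)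
qed

text \<open>
  Pushing the entries from \<open>I\<close> to the top of their columns moves them into the first \<open>card I\<close>
  rows, as columns are strictly increasing.
\<close>

lemma card_ssyt_entries_le:
  fixes T :: "nat \<times> nat \<Rightarrow> 'm::{finite,linorder}"
  assumes part: "partition_at_most m \<mu>" and T: "T \<in> ssyt \<mu>"
  shows "card {c \<in> cells \<mu>. T c \<in> I} \<le> (\<Sum>i<card I. \<mu> i)"
proof -
  define above where "above = (\<lambda>i j. {i'. i' < i \<and> T (i', j) \<in> I})"
  define f where "f = (\<lambda>(i, j). (card (above i j), j))"
  have fin: "finite (above i j)" for i j
    by (simp add: above_def)
  have up: "(i', j) \<in> cells \<mu>" if "(i, j) \<in> cells \<mu>" "i' \<le> i" for i i' j
    using that part by (auto simp: skew_cells_def partition_at_most_def antimono_def intro: less_le_trans)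
  have strict: "T (i, j) < T (i', j)" if "(i', j) \<in> cells \<mu>" "i < i'" for i i' j
    using T that up[of i' j i] by (auto simp: ssyt_def)
  have "inj_on f {c \<in> cells \<mu>. T c \<in> I}"
  proof (rule inj_onI, clarify)
    fix i j i' j'
    assume c: "T (i, j) \<in> I" "T (i', j') \<in> I" and eq: "f (i, j) = f (i', j')"
    have less: "card (above i j) < card (above i' j)" if "i < i'" "T (i, j) \<in> I" for i i'
      using that by (intro psubset_card_mono fin) (auto simp: above_def)
    show "i = i' \<and> j = j'"
      using eq c less[of i i'] less[of i' i] by (cases i i' rule: linorder_cases) (auto simp: f_def)
  qed
  moreover have "f c \<in> (SIGMA i:{..<card I}. {..<\<mu> i})" if c: "c \<in> cells \<mu>" "T c \<in> I" for c
  proof -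
    obtain i j where ij: "c = (i, j)"
      by (cases c)
    have "inj_on (\<lambda>i'. T (i', j)) (insert i (above i j))"
      using strict up c ij by (intro linorder_inj_onI' less_imp_neq) (auto simp: above_def)
    moreover have "(\<lambda>i'. T (i', j)) ` insert i (above i j) \<subseteq> I"
      using c ij by (auto simp: above_def)
    ultimately have "card (insert i (above i j)) \<le> card I"
      by (intro card_inj_on_le) auto
    then have "card (above i j) < card I"
      using fin by (simp add: above_def)
    moreover have "card (above i j) \<le> card {..<i}"
      by (intro card_mono) (auto simp: above_def)
    then have "(card (above i j), j) \<in> cells \<mu>"
      using up c ij by simp
    ultimately show ?thesis
      by (simp add: f_def ij skew_cells_def)
  qed
  then have "f ` {c \<in> cells \<mu>. T c \<in> I} \<subseteq> (SIGMA i:{..<card I}. {..<\<mu> i})"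
    by (intro image_subsetI) simp
  ultimately have "card {c \<in> cells \<mu>. T c \<in> I} \<le> card (SIGMA i:{..<card I}. {..<\<mu> i})"
    by (intro card_inj_on_le[of f]) simp_all
  then show ?thesis by simp
qed

text \<open>The first \<open>i + 1\<close> elements of \<open>A\<close> all lie in \<open>B\<close>;
  if the element of \<open>B\<close> at index \<open>i\<close> were larger than that of
  \<open>A\<close>, at most \<open>i\<close> elements of \<open>B\<close> could be so small. This
  makes the rows of the tableaux below weakly increasing.\<close>

lemma sorted_list_of_set_nth_antimono:
  fixes A B :: "'a::linorder set"
  assumes "A \<subseteq> B" "finite B" "i < card A"
  shows "sorted_list_of_set B ! i \<le> sorted_list_of_set A ! i"
proof (rule ccontr)
  define xs ys where "xs = sorted_list_of_set A" and "ys = sorted_list_of_set B"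
  have "finite A" using assms finite_subset by auto
  then have xs: "set xs = A" "distinct xs" "length xs = card A" "sorted xs"
    by (auto simp: xs_def)
  have ys: "set ys = B" "length ys = card B" "sorted ys"
    using assms by (auto simp: ys_def)
  assume "\<not> ?thesis"
  then have less: "xs ! i < ys ! i"
    by (simp add: xs_def ys_def)
  have "inj_on ((!) xs) {..i}"
    using xs assms by (auto simp: inj_on_def nth_eq_iff_index_eq)
  then have "Suc i = card ((!) xs ` {..i})"
    by (simp add: card_image)
  also have "\<dots> \<le> card {b\<in>B. b \<le> xs ! i}"
    using assms xs by (intro card_mono) (auto intro!: sorted_nth_mono)
  also have "\<dots> \<le> card ((!) ys ` {..<i})"
  proof (intro card_mono subsetI)
    fix b assume b: "b \<in> {b\<in>B. b \<le> xs ! i}"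
    then obtain j where j: "j < length ys" "b = ys ! j"
      using ys by (metis (mono_tags, lifting) in_set_conv_nth mem_Collect_eq)
    have "j < i"
    proof (rule ccontr)
      assume "\<not> j < i"
      then have "ys ! i \<le> ys ! j"
        using j ys by (intro sorted_nth_mono) auto
      with b j less show False by auto
    qed
    with j show "b \<in> (!) ys ` {..<i}" by auto
  qed simp
  also have "\<dots> \<le> i"
    using card_image_le[of "{..<i}" "(!) ys"] by simp
  finally show False by simp
qed

text \<open>Key tableaux: their columns, read as sets, are nested.\<close>

lemma ssyt_of_permuted_weight:
  fixes \<tau> :: "'m::{finite,linorder} \<Rightarrow> nat"
  assumes part: "partition_at_most CARD('m) \<mu>" and bij: "bij_betw \<tau> UNIV {..<CARD('m)}"
  obtains T where "T \<in> ssyt \<mu>" "\<And>k. Poly_Mapping.lookup (content T (cells \<mu>)) k = \<mu> (\<tau> k)"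
proof -
  \<comment> \<open>The entries of column \<open>j\<close>: each \<open>k\<close> is placed in the
    first \<open>\<mu> (\<tau> k)\<close> columns, hence occurs with the required
    multiplicity.\<close>
  define S where "S = (\<lambda>j. {k. j < \<mu> (\<tau> k)})"
  define T where "T = restrict (\<lambda>(i, j). sorted_list_of_set (S j) ! i) (cells \<mu>)"
  have mono: "\<mu> i' \<le> \<mu> i" if "i \<le> i'" for i i'
    using part that by (auto simp: partition_at_most_def antimono_def)
  have row: "i < CARD('m)" if "j < \<mu> i" for i j
    using part that unfolding partition_at_most_def by (metis not_less not_less0)
  \<comment> \<open>Through \<open>\<tau>\<close>, the size of \<open>S j\<close> is the number of
    rows longer than \<open>j\<close>. These rows form an initial segment, so \<open>S j\<close>
    fills column \<open>j\<close> exactly.\<close>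
  have cell: "i < card (S j) \<longleftrightarrow> j < \<mu> i" for i j
  proof -
    have "bij_betw \<tau> (S j) {i. i < CARD('m) \<and> j < \<mu> i}"
    proof (rule bij_betw_subset[OF bij])
      have "\<tau> ` S j = {i \<in> \<tau> ` UNIV. j < \<mu> i}"
        by (auto simp: S_def)
      then show "\<tau> ` S j = {i. i < CARD('m) \<and> j < \<mu> i}"
        using bij by (simp add: bij_betw_def)
    qed simp
    also have "{i. i < CARD('m) \<and> j < \<mu> i} = {i. j < \<mu> i}"
      using row by auto
    finally have card: "card (S j) = card {i. j < \<mu> i}"
      by (rule bij_betw_same_card)
    have fin: "finite {i. j < \<mu> i}"
      by (rule finite_subset[of _ "{..<CARD('m)}"]) (auto dest: row)
    show ?thesis
    proof
      assume "j < \<mu> i"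
      then have "{..i} \<subseteq> {i. j < \<mu> i}"
        using mono by (auto intro: less_le_trans)
      then have "card {..i} \<le> card (S j)"
        unfolding card by (intro card_mono fin)
      then show "i < card (S j)" by simp
    next
      assume i: "i < card (S j)"
      show "j < \<mu> i"
      proof (rule ccontr)
        assume "\<not> j < \<mu> i"
        then have "i' < i" if "j < \<mu> i'" for i'
          using mono[of i i'] that by (cases "i' < i") auto
        then have "{i. j < \<mu> i} \<subseteq> {..<i}"
          by auto
        then have "card (S j) \<le> card {..<i}"
          unfolding card by (intro card_mono) auto
        with i show False by simp
      qed
    qed
  qed
  have T: "T (i, j) = sorted_list_of_set (S j) ! i" if "i < card (S j)" for i j
    using that cell by (simp add: T_def skew_cells_def)
  have cells: "(i, j) \<in> cells \<mu> \<longleftrightarrow> i < card (S j)" for i j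
    by (simp add: cell skew_cells_def)
  have "T \<in> ssyt \<mu>"
    unfolding ssyt_def
  proof (intro CollectI conjI allI impI)
    show "T \<in> cells \<mu> \<rightarrow>\<^sub>E UNIV"
      by (simp add: T_def)
    fix i j j' assume "(i, j) \<in> cells \<mu>" "(i, j') \<in> cells \<mu>" "j < j'"
    then show "T (i, j) \<le> T (i, j')"
      by (auto simp: T cells S_def intro!: sorted_list_of_set_nth_antimono)
  next
    fix i i' j assume "(i, j) \<in> cells \<mu>" "(i', j) \<in> cells \<mu>" "i < i'"
    then show "T (i, j) < T (i', j)"
      using sorted_wrt_nth_less[OF strict_sorted_list_of_set, of i i' "S j"] by (simp add: T cells)
  qed
  moreover have "Poly_Mapping.lookup (content T (cells \<mu>)) k = \<mu> (\<tau> k)" for k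
  proof -
    have "bij_betw snd {c \<in> cells \<mu>. T c = k} {..<\<mu> (\<tau> k)}"
    proof (rule bij_betw_imageI)
      show "inj_on snd {c \<in> cells \<mu>. T c = k}"
        by (auto simp: inj_on_def T cells nth_eq_iff_index_eq)
      show "snd ` {c \<in> cells \<mu>. T c = k} = {..<\<mu> (\<tau> k)}"
      proof (intro equalityI subsetI)
        fix j assume "j \<in> snd ` {c \<in> cells \<mu>. T c = k}"
        then obtain i where "i < card (S j)" "sorted_list_of_set (S j) ! i = k"
          by (auto simp: T cells)
        then have "k \<in> S j"
          using nth_mem[of i "sorted_list_of_set (S j)"] by simp
        then show "j \<in> {..<\<mu> (\<tau> k)}" by (simp add: S_def)
      next
        fix j assume "j \<in> {..<\<mu> (\<tau> k)}"
        then have "k \<in> set (sorted_list_of_set (S j))"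
          by (simp add: S_def)
        then obtain i where "i < card (S j)" "sorted_list_of_set (S j) ! i = k"
          by (metis in_set_conv_nth length_sorted_list_of_set)
        then show "j \<in> snd ` {c \<in> cells \<mu>. T c = k}"
          by (intro image_eqI[of _ _ "(i, j)"]) (auto simp: T cells)
      qed
    qed
    then show ?thesis
      using bij_betw_same_card by (fastforce simp: lookup_content[OF finite_skew_cells[OF part]])
  qed
  ultimately show ?thesis
    using that by blast
qed

section \<open>The index set and the support of \<open>G\<close>\<close>

text \<open>Row \<open>s\<close> has room for \<open>h * s\<close> new cells; the running minimum is
  there because no row is longer than a row above it.\<close>

definition row_bound :: "nat \<Rightarrow> (nat \<Rightarrow> nat) \<Rightarrow> nat \<Rightarrow> nat" where
  "row_bound h lam r = Min ((\<lambda>s. lam s + h * s) ` {..r})"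

lemma row_bound_le: "s \<le> r \<Longrightarrow> row_bound h lam r \<le> lam s + h * s"
  by (simp add: row_bound_def)

lemma le_row_boundI: "(\<And>s. s \<le> r \<Longrightarrow> x \<le> lam s + h * s) \<Longrightarrow> x \<le> row_bound h lam r"
  by (simp add: row_bound_def)

lemma row_bound_antimono: "r \<le> r' \<Longrightarrow> row_bound h lam r' \<le> row_bound h lam r"
  by (intro le_row_boundI row_bound_le) simp

lemma le_row_bound: "antimono lam \<Longrightarrow> lam r \<le> row_bound h lam r"
  by (intro le_row_boundI) (auto simp: antimono_def intro: trans_le_add1)

text \<open>The new cells of row \<open>s\<close> carry distinct numbers from
  \<open>{1..h * s}\<close>, which bounds the length of row \<open>s\<close> and so of every later
  row \<open>r\<close>.\<close>

lemma A_setD: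
  assumes "\<mu> \<in> A_set m h lam"
  shows "\<mu> r \<le> row_bound h lam r"
proof (rule le_row_boundI)
  fix s assume "s \<le> r"
  have part: "partition_at_most m \<mu>" and "b_coeff h lam \<mu> \<noteq> 0"
    using assms by (auto simp: A_set_def)
  then obtain F where F: "F \<in> flagged_fillings h lam \<mu>"
    by (metis all_not_in_conv b_coeff_def card.empty)
  then have range: "F (s, j) \<in> {1..h * s}" if "(s, j) \<in> skew_cells \<mu> lam" for j
    using that by (auto simp: flagged_fillings_def dest: PiE_mem)
  have "inj_on (\<lambda>j. F (s, j)) {lam s..<\<mu> s}"
    using F by (intro linorder_inj_onI' less_imp_neq) (auto simp: flagged_fillings_def skew_cells_def)
  moreover have "(\<lambda>j. F (s, j)) ` {lam s..<\<mu> s} \<subseteq> {1..h * s}"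
    using range by (auto simp: skew_cells_def)
  ultimately have "card {lam s..<\<mu> s} \<le> card {1..h * s}"
    by (intro card_inj_on_le) auto
  then have "\<mu> s \<le> lam s + h * s"
    by simp
  moreover have "\<mu> r \<le> \<mu> s"
    using part \<open>s \<le> r\<close> by (simp add: partition_at_most_def antimono_def)
  ultimately show "\<mu> r \<le> lam s + h * s" by simp
qed

text \<open>The witness fills each row with the largest admissible numbers.\<close>

lemma A_setI:
  assumes h: "h \<ge> 1" and part: "partition_at_most m \<mu>" and "lam \<le> \<mu>"
    and le: "\<And>r. \<mu> r \<le> lam r + h * r"
  shows "\<mu> \<in> A_set m h lam"
proof -
  \<comment> \<open>The last cell of row \<open>i\<close> receives \<open>h * i\<close> and the
    entries drop by one to the left; by \<open>le\<close> the first one is still at least 1.\<close>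
  define F where "F = restrict (\<lambda>(i, j). h * i + j + 1 - \<mu> i) (skew_cells \<mu> lam)"
  have F: "F (i, j) = h * i + j + 1 - \<mu> i \<and> \<mu> i \<le> h * i + j \<and> j < \<mu> i"
    if "(i, j) \<in> skew_cells \<mu> lam" for i j
    using that le[of i] by (auto simp: F_def skew_cells_def)
  have "F \<in> flagged_fillings h lam \<mu>"
    unfolding flagged_fillings_def
  proof (intro CollectI conjI allI impI)
    have "F (i, j) \<in> {1..h * i}" if "(i, j) \<in> skew_cells \<mu> lam" for i j
      using F[OF that] by auto
    then show "F \<in> (\<Pi>\<^sub>E (i, j)\<in>skew_cells \<mu> lam. {1..h * i})"
      by (intro PiE_I) (auto simp: F_def)
    fix i j j' assume "(i, j) \<in> skew_cells \<mu> lam" "(i, j') \<in> skew_cells \<mu> lam" "j < j'"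
    then show "F (i, j) < F (i, j')"
      using F[of i j] F[of i j'] by auto
  next
    fix i i' j assume *: "(i, j) \<in> skew_cells \<mu> lam" "(i', j) \<in> skew_cells \<mu> lam" "i < i'"
    \<comment> \<open>Down a column \<open>j\<close> is fixed, \<open>h * i\<close> grows strictly
      as \<open>h\<close> is positive, and the subtracted row length does not grow.\<close>
    have "\<mu> i' \<le> \<mu> i"
      using part * by (simp add: partition_at_most_def antimono_def)
    moreover have "h * i < h * i'"
      using h * by simp
    ultimately show "F (i, j) < F (i', j)"
      using F[OF *(1)] F[OF *(2)] by linarith
  qed
  then have "b_coeff h lam \<mu> \<noteq> 0"
    using finite_flagged_fillings[OF part] by (auto simp: b_coeff_def)
  with assms show ?thesis by (simp add: A_set_def)
qed

section \<open>Coefficients and exponents of \<open>G_poly\<close>\<close>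

lemma lookup_signed_of_nat_mult:
  fixes p :: "'m mpoly"
  shows "Poly_Mapping.lookup ((- 1) ^ n * of_nat b * p) e = (- 1) ^ n * int b * Poly_Mapping.lookup p e"
proof -
  have b: "Poly_Mapping.lookup (of_nat b * p) e = int b * Poly_Mapping.lookup p e"
    by (induction b) (simp_all add: algebra_simps lookup_add)
  have "Poly_Mapping.lookup ((- 1) ^ n * q) e = (- 1) ^ n * Poly_Mapping.lookup q e" for q :: "'m mpoly"
    by (cases "even n") simp_all
  then show ?thesis
    by (simp add: b mult.assoc)
qed

text \<open>No cancellation: the sign of a monomial in \<open>G\<close> is determined by its degree.\<close>

lemma keys_G_poly:
  assumes lam: "partition_at_most CARD('m::{finite,linorder}) lam"
  shows "Poly_Mapping.keys (G_poly h lam :: 'm mpoly) =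
    {content T (cells \<mu>) | T \<mu>. \<mu> \<in> A_set CARD('m) h lam \<and> T \<in> ssyt \<mu>}"
proof (intro set_eqI)
  fix e :: "'m \<Rightarrow>\<^sub>0 nat"
  let ?A = "A_set CARD('m) h lam"
  define K where "K = (\<lambda>\<mu>. card {T \<in> ssyt \<mu>. content T (cells \<mu>) = e})"
  define s :: int where "s = (- 1) ^ ((\<Sum>k\<in>UNIV. Poly_Mapping.lookup e k) - card (cells lam))"
  have part: "partition_at_most CARD('m) \<mu>" if "\<mu> \<in> ?A" for \<mu>
    using that by (simp add: A_set_def)
  have "Poly_Mapping.lookup (G_poly h lam :: 'm mpoly) e =
      (\<Sum>\<mu>\<in>?A. (- 1) ^ card (skew_cells \<mu> lam) * int (b_coeff h lam \<mu>) * int (K \<mu>))"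
    by (simp add: G_poly_def lookup_sum lookup_signed_of_nat_mult lookup_schur[OF part] K_def)
  also have "\<dots> = (\<Sum>\<mu>\<in>?A. s * int (b_coeff h lam \<mu> * K \<mu>))"
  proof (intro sum.cong refl)
    fix \<mu> assume \<mu>: "\<mu> \<in> ?A"
    show "(- 1) ^ card (skew_cells \<mu> lam) * int (b_coeff h lam \<mu>) * int (K \<mu>) =
        s * int (b_coeff h lam \<mu> * K \<mu>)"
    \<comment> \<open>A partition whose size is not the degree of \<open>e\<close> may carry the
      other sign, but then \<open>K \<mu> = 0\<close> and both sides vanish.\<close>
    proof (cases "K \<mu> = 0")
      case False
      then obtain T where "content T (cells \<mu>) = e"
        unfolding K_def by (metis (mono_tags, lifting) card.empty empty_Collect_eq)
      then have "(\<Sum>k\<in>UNIV. Poly_Mapping.lookup e k) = card (cells \<mu>)"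
        using sum_lookup_content[OF finite_skew_cells[OF part[OF \<mu>]], of UNIV T] by auto
      then show ?thesis
        using card_skew_cells[OF part[OF \<mu>] lam] \<mu> by (simp add: s_def A_set_def)
    qed simp
  qed
  also have "\<dots> = s * int (\<Sum>\<mu>\<in>?A. b_coeff h lam \<mu> * K \<mu>)"
    by (simp add: sum_distrib_left)
  finally have "e \<in> Poly_Mapping.keys (G_poly h lam :: 'm mpoly) \<longleftrightarrow> (\<Sum>\<mu>\<in>?A. b_coeff h lam \<mu> * K \<mu>) \<noteq> 0"
    by (simp add: in_keys_iff s_def del: of_nat_sum)
  also have "\<dots> \<longleftrightarrow> (\<exists>\<mu>\<in>?A. K \<mu> \<noteq> 0)"
    by (auto simp: sum_eq_0_iff[OF finite_A_set]) (auto simp: A_set_def)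
  also have "\<dots> \<longleftrightarrow> (\<exists>\<mu>\<in>?A. \<exists>T\<in>ssyt \<mu>. content T (cells \<mu>) = e)"
    by (intro bex_cong refl) (auto simp: K_def finite_ssyt[OF part])
  finally show "e \<in> Poly_Mapping.keys (G_poly h lam :: 'm mpoly) \<longleftrightarrow>
      e \<in> {content T (cells \<mu>) | T \<mu>. \<mu> \<in> ?A \<and> T \<in> ssyt \<mu>}"
    by auto
qed

text \<open>The upper bound comes from pushing entries up and bounding the rows of
  \<open>\<mu>\<close>. For the lower one, the total is the size of \<open>\<mu>\<close>, so what
  \<open>I\<close> cannot hold, at least the rows of \<open>\<mu>\<close> from \<open>card I\<close>
  on, falls to the complement.\<close>

lemma keys_G_poly_bounds:
  assumes lam: "partition_at_most CARD('m::{finite,linorder}) lam"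
    and e: "e \<in> Poly_Mapping.keys (G_poly h lam :: 'm mpoly)"
  shows "(\<Sum>k\<in>I. Poly_Mapping.lookup e k) \<le> (\<Sum>i<card I. row_bound h lam i)"
    and "(\<Sum>i\<in>{card I..<CARD('m)}. lam i) \<le> (\<Sum>k\<in>-I. Poly_Mapping.lookup e k)"
proof -
  obtain T \<mu> where e: "e = content T (cells \<mu>)" and \<mu>: "\<mu> \<in> A_set CARD('m) h lam"
    and T: "T \<in> ssyt \<mu>"
    using e unfolding keys_G_poly[OF lam] by auto
  have part: "partition_at_most CARD('m) \<mu>"
    using \<mu> by (simp add: A_set_def)
  have sum: "(\<Sum>k\<in>J. Poly_Mapping.lookup e k) = card {c \<in> cells \<mu>. T c \<in> J}" for J
    unfolding e by (intro sum_lookup_content finite_skew_cells[OF part]) simp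
  have upper: "(\<Sum>k\<in>I. Poly_Mapping.lookup e k) \<le> (\<Sum>i<card I. \<mu> i)"
    unfolding sum by (rule card_ssyt_entries_le[OF part T])
  also have "\<dots> \<le> (\<Sum>i<card I. row_bound h lam i)"
    by (intro sum_mono A_setD[OF \<mu>])
  finally show "(\<Sum>k\<in>I. Poly_Mapping.lookup e k) \<le> (\<Sum>i<card I. row_bound h lam i)" .
  have "card I \<le> CARD('m)"
    by (simp add: card_mono)
  then have split: "(\<Sum>i<CARD('m). \<mu> i) = (\<Sum>i<card I. \<mu> i) + (\<Sum>i\<in>{card I..<CARD('m)}. \<mu> i)"
    by (subst sum.union_disjoint[symmetric]) (auto intro: sum.cong)
  have "(\<Sum>k\<in>I. Poly_Mapping.lookup e k) + (\<Sum>k\<in>-I. Poly_Mapping.lookup e k) = (\<Sum>k\<in>UNIV. Poly_Mapping.lookup e k)"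
    by (subst sum.union_disjoint[symmetric]) (auto intro: sum.cong)
  also have "\<dots> = (\<Sum>i<CARD('m). \<mu> i)"
    using sum[of UNIV] card_cells[OF part] by simp
  finally have "(\<Sum>i\<in>{card I..<CARD('m)}. \<mu> i) \<le> (\<Sum>k\<in>-I. Poly_Mapping.lookup e k)"
    using upper split by linarith
  moreover have "(\<Sum>i\<in>{card I..<CARD('m)}. lam i) \<le> (\<Sum>i\<in>{card I..<CARD('m)}. \<mu> i)"
    using \<mu> by (intro sum_mono) (auto simp: A_set_def le_fun_def)
  ultimately show "(\<Sum>i\<in>{card I..<CARD('m)}. lam i) \<le> (\<Sum>k\<in>-I. Poly_Mapping.lookup e k)"
    by linarith
qed

section \<open>Half-spaces containing the Newton polytope\<close>

lemma convex_sum_component_le: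
  "convex {x :: real ^ 'm::finite. (\<Sum>k\<in>I. x $ k) \<le> c}"
proof -
  have "linear (\<lambda>x :: real ^ 'm. \<Sum>k\<in>I. x $ k)"
    by (intro linearI) (simp_all add: sum.distrib sum_distrib_left)
  from convex_linear_vimage[OF this, of "{..c}"] show ?thesis
    by (simp add: vimage_def)
qed

lemma convex_sum_component_ge:
  "convex {x :: real ^ 'm::finite. c \<le> (\<Sum>k\<in>I. x $ k)}"
proof -
  have "linear (\<lambda>x :: real ^ 'm. \<Sum>k\<in>I. x $ k)"
    by (intro linearI) (simp_all add: sum.distrib sum_distrib_left)
  from convex_linear_vimage[OF this, of "{c..}"] show ?thesis
    by (simp add: vimage_def)
qed

lemma Newt_G_poly_bounds:
  assumes lam: "partition_at_most CARD('m::{finite,linorder}) lam"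
    and x: "x \<in> Newt (G_poly h lam :: 'm mpoly)"
  shows "(\<Sum>k\<in>I. x $ k) \<le> real (\<Sum>i<card I. row_bound h lam i)"
    and "real (\<Sum>i\<in>{card I..<CARD('m)}. lam i) \<le> (\<Sum>k\<in>-I. x $ k)"
proof -
  let ?E = "exponent_vector ` Poly_Mapping.keys (G_poly h lam :: 'm mpoly)"
  have "?E \<subseteq> {x. (\<Sum>k\<in>I. x $ k) \<le> real (\<Sum>i<card I. row_bound h lam i)}"
    using keys_G_poly_bounds(1)[OF lam]
    by (auto simp: exponent_vector_def simp flip: of_nat_sum)
  from hull_minimal[of _ _ convex, OF this convex_sum_component_le] x
  show "(\<Sum>k\<in>I. x $ k) \<le> real (\<Sum>i<card I. row_bound h lam i)"
    by (auto simp: Newt_def)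
  have "?E \<subseteq> {x. real (\<Sum>i\<in>{card I..<CARD('m)}. lam i) \<le> (\<Sum>k\<in>-I. x $ k)}"
    using keys_G_poly_bounds(2)[OF lam]
    by (auto simp: exponent_vector_def simp flip: of_nat_sum)
  from hull_minimal[of _ _ convex, OF this convex_sum_component_ge] x
  show "real (\<Sum>i\<in>{card I..<CARD('m)}. lam i) \<le> (\<Sum>k\<in>-I. x $ k)"
    by (auto simp: Newt_def)
qed

section \<open>Integer decomposition\<close>

definition real_vec :: "('m \<Rightarrow> int) \<Rightarrow> real ^ 'm" where
  "real_vec u = (\<chi> k. real_of_int (u k))"

text \<open>
  For \<open>d = u a - u b > 0\<close>, moving one unit from \<open>a\<close> to \<open>b\<close> gives the convex combination of \<open>u\<close> and
  its image under the transposition of \<open>a\<close> and \<open>b\<close> with weights \<open>1 - 1/d\<close> and \<open>1/d\<close>.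
\<close>

lemma transfer_closed_symmetric_hull:
  fixes X :: "(real ^ 'm::finite) set"
  assumes sym: "\<And>a b x. x \<in> X \<Longrightarrow> (\<chi> k. x $ Transposition.transpose a b k) \<in> X"
  shows "transfer_closed {u. real_vec u \<in> convex hull X}"
  unfolding transfer_closed_def
proof (intro ballI allI impI)
  fix u :: "'m \<Rightarrow> int" and a b
  assume u: "u \<in> {u. real_vec u \<in> convex hull X}" and less: "u b < u a"
  define f :: "real ^ 'm \<Rightarrow> real ^ 'm" where "f = (\<lambda>x. \<chi> k. x $ Transposition.transpose a b k)"
  have "linear f"
    by (intro linearI) (simp_all add: f_def vec_eq_iff)
  then have "f ` (convex hull X) = convex hull (f ` X)"
    by (simp add: convex_hull_linear_image)
  also have "\<dots> \<subseteq> convex hull X"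
    using sym by (intro hull_mono) (auto simp: f_def)
  finally have fu: "f (real_vec u) \<in> convex hull X"
    using u by auto
  define d where "d = real_of_int (u a - u b)"
  have d: "d \<ge> 1"
    using less by (simp add: d_def)
  have "real_vec (u(a := u a - 1, b := u b + 1)) =
      (1 - 1 / d) *\<^sub>R real_vec u + (1 / d) *\<^sub>R f (real_vec u)"
    unfolding vec_eq_iff
  proof
    fix k
    have "a \<noteq> b" using less by auto
    have "real_of_int (u a) = real_of_int (u b) + d"
      by (simp add: d_def)
    then show "real_vec (u(a := u a - 1, b := u b + 1)) $ k =
        ((1 - 1 / d) *\<^sub>R real_vec u + (1 / d) *\<^sub>R f (real_vec u)) $ k"
      using d \<open>a \<noteq> b\<close>
      by (cases "k = a"; cases "k = b") (auto simp: real_vec_def f_def field_simps)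
  qed
  also have "\<dots> \<in> convex hull X"
    using d u fu by (intro convexD[OF convex_convex_hull]) auto
  finally show "u(a := u a - 1, b := u b + 1) \<in> {u. real_vec u \<in> convex hull X}"
    by simp
qed

text \<open>Serves to distribute the single intermediate entry \<open>c\<close> over
  \<open>t\<close> partitions.\<close>

lemma split_sum_between:
  fixes a b c :: int
  assumes "int t * a \<le> c" "c \<le> int t * b" "a \<le> b"
  obtains f where "\<And>j. j \<in> {1..t} \<Longrightarrow> a \<le> f j \<and> f j \<le> b" "(\<Sum>j=1..t. f j) = c"
proof -
  have "\<exists>f. (\<forall>j\<in>{1..t}. a \<le> f j \<and> f j \<le> b) \<and> (\<Sum>j=1..t. f j) = c"
    using assms(1,2)
  proof (induction t arbitrary: c)
    case (Suc t)
    \<comment> \<open>The smallest last summand that leaves no more than \<open>t * b\<close> to the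
      others.\<close>
    define x where "x = max a (c - int t * b)"
    have x: "a \<le> x" "x \<le> b" "int t * a \<le> c - x" "c - x \<le> int t * b"
      using Suc.prems assms(3) mult_left_mono[of a b "int t"] by (auto simp: x_def algebra_simps)
    then obtain f where f: "\<forall>j\<in>{1..t}. a \<le> f j \<and> f j \<le> b" "(\<Sum>j=1..t. f j) = c - x"
      using Suc.IH by blast
    have "(\<Sum>j=1..Suc t. (f(Suc t := x)) j) = (\<Sum>j=1..t. f j) + x"
      by simp
    then show ?case
      using f x by (intro exI[of _ "f(Suc t := x)"]) (auto simp: le_Suc_eq)
  qed auto
  then obtain f where "\<forall>j\<in>{1..t}. a \<le> f j \<and> f j \<le> b" "(\<Sum>j=1..t. f j) = c"
    by blast
  then show ?thesis
    using that[of f] by simp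
qed

text \<open>A discrete intermediate value argument; it locates the row where upper bounds give way
  to parts of \<open>lam\<close>.\<close>

lemma interpolating_step:
  fixes g :: "nat \<Rightarrow> int"
  assumes "g 0 \<le> n" "n \<le> g m" "0 < m"
  obtains r where "r < m" "g r \<le> n" "n \<le> g (Suc r)"
  using assms
proof (induction m)
  case (Suc m)
  show ?case
  proof (cases "m > 0 \<and> n \<le> g m")
    case True
    then show ?thesis using Suc by (metis less_SucI)
  next
    case False
    then show ?thesis using Suc.prems(1)[of m] Suc.prems(2,3) by force
  qed
qed simp

theorem theorem3p17:
  fixes h :: nat and lam :: "nat \<Rightarrow> nat"
  assumes "h \<ge> 1"
    and "partition_at_most CARD('m::{finite,linorder}) lam"
  shows "has_IDP (Newt (G_poly h lam :: 'm mpoly))"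
  unfolding has_IDP_def
proof (intro conjI allI impI ballI)
  note lam = assms(2)
  let ?m = "CARD('m)"
  let ?E = "exponent_vector ` Poly_Mapping.keys (G_poly h lam :: 'm mpoly)"
  let ?P = "Newt (G_poly h lam :: 'm mpoly)"
  have "?E \<subseteq> lattice_points"
    by (auto simp: exponent_vector_def lattice_points_def)
  then show "lattice_polytope ?P"
    unfolding lattice_polytope_def Newt_def by (intro exI[of _ ?E]) simp
  fix t :: nat and p
  assume t: "t \<ge> 1" and p: "p \<in> (\<lambda>x. real t *\<^sub>R x) ` ?P \<inter> lattice_points"
  from p obtain x where x: "x \<in> ?P" "p = real t *\<^sub>R x"
    by auto
  define u where "u = (\<lambda>k. \<lfloor>p $ k\<rfloor>)"
  have pu: "p = real_vec u"
    using p by (simp add: real_vec_def u_def vec_eq_iff lattice_points_def of_int_floor)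
  have tx: "real_of_int (\<Sum>k\<in>I. u k) = real t * (\<Sum>k\<in>I. x $ k)" for I
  proof -
    have "real_of_int (u k) = real t * x $ k" for k
      using arg_cong[OF trans[OF pu[symmetric] x(2)], of "\<lambda>y. y $ k"] by (simp add: real_vec_def)
    then show ?thesis by (simp add: sum_distrib_left)
  qed
  define M where "M = row_bound h lam"
  have upper: "(\<Sum>k\<in>I. u k) \<le> int t * (\<Sum>i<card I. int (M i))" for I
  proof -
    have "real_of_int (\<Sum>k\<in>I. u k) \<le> real t * real (\<Sum>i<card I. M i)"
      unfolding tx M_def by (intro mult_left_mono Newt_G_poly_bounds(1)[OF lam x(1)]) simp
    also have "\<dots> = real_of_int (int t * (\<Sum>i<card I. int (M i)))"
      by simp
    finally show ?thesis by linarith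
  qed
  have lower: "int t * (\<Sum>i\<in>{card I..<?m}. int (lam i)) \<le> (\<Sum>k\<in>-I. u k)" for I
  proof -
    have "real_of_int (int t * (\<Sum>i\<in>{card I..<?m}. int (lam i))) =
        real t * real (\<Sum>i\<in>{card I..<?m}. lam i)"
      by simp
    also have "\<dots> \<le> real_of_int (\<Sum>k\<in>-I. u k)"
      unfolding tx by (intro mult_left_mono Newt_G_poly_bounds(2)[OF lam x(1)]) simp
    finally show ?thesis by linarith
  qed

  \<comment> \<open>Permuted partitions suffice: this subset of the exponents is visibly symmetric,
    and summands found in its hull lie in the polytope.\<close>
  define X where "X = {(\<chi> k. real (\<mu> (\<tau> k))) :: (real, 'm) vec | \<mu> \<tau>.
    \<mu> \<in> A_set ?m h lam \<and> bij_betw \<tau> UNIV {..<?m}}"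
  have "X \<subseteq> ?E"
  proof
    fix y assume "y \<in> X"
    then obtain \<mu> \<tau> where y: "y = (\<chi> k. real (\<mu> (\<tau> k)))" and \<mu>: "\<mu> \<in> A_set ?m h lam"
      and \<tau>: "bij_betw \<tau> (UNIV :: 'm set) {..<?m}"
      by (auto simp: X_def)
    have "partition_at_most ?m \<mu>"
      using \<mu> by (simp add: A_set_def)
    then obtain T where T: "T \<in> ssyt \<mu>" "\<And>k. Poly_Mapping.lookup (content T (cells \<mu>)) k = \<mu> (\<tau> k)"
      using \<tau> by (rule ssyt_of_permuted_weight) blast
    then have "content T (cells \<mu>) \<in> Poly_Mapping.keys (G_poly h lam :: 'm mpoly)"
      using \<mu> by (auto simp: keys_G_poly[OF lam])
    then show "y \<in> ?E"
      by (intro image_eqI[of _ _ "content T (cells \<mu>)"]) (auto simp: y exponent_vector_def T)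
  qed
  then have XP: "convex hull X \<subseteq> ?P"
    unfolding Newt_def by (rule hull_mono)
  have "(\<chi> k. y $ Transposition.transpose a b k) \<in> X" if yX: "y \<in> X" for a b y
  proof -
    obtain \<mu> \<tau> where y: "y = (\<chi> k. real (\<mu> (\<tau> k)))" and \<mu>: "\<mu> \<in> A_set ?m h lam"
      and \<tau>: "bij_betw \<tau> (UNIV :: 'm set) {..<?m}"
      using yX by (auto simp: X_def)
    have "bij_betw (\<tau> \<circ> Transposition.transpose a b) UNIV {..<?m}"
      using \<tau> by (intro bij_betw_trans) auto
    then show ?thesis
      using \<mu> by (auto simp: X_def y intro!: exI[of _ \<mu>] exI[of _ "\<tau> \<circ> Transposition.transpose a b"])
  qed
  then have W: "transfer_closed {u. real_vec u \<in> convex hull X}"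
    by (rule transfer_closed_symmetric_hull)
  define R where "R = {\<lambda>k. \<Sum>j\<in>{1..t}. v j k | v. \<forall>j\<in>{1..t}. v j \<in> {u. real_vec u \<in> convex hull X}}"
  have R: "transfer_closed R"
    unfolding R_def by (intro transfer_closed_sum W) simp

  obtain \<sigma> where \<sigma>: "bij_betw \<sigma> {..<?m} (UNIV :: 'm set)"
    and sorted: "\<And>i j. i \<le> j \<Longrightarrow> j < ?m \<Longrightarrow> u (\<sigma> j) \<le> u (\<sigma> i)"
    using decreasing_enumeration by blast
  have inj: "inj_on \<sigma> {..<k}" if "k \<le> ?m" for k
    using \<sigma> that by (auto simp: bij_betw_def intro: inj_on_subset)
  define n where "n = (\<Sum>k\<in>UNIV. u k)"
  \<comment> \<open>\<open>g r\<close> is the total of the vector with entries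
    \<open>t * M i\<close> before row \<open>r\<close> and \<open>t * lam i\<close> from there
    on.\<close>
  define g where "g = (\<lambda>r. int t * ((\<Sum>i<r. int (M i)) + (\<Sum>i\<in>{r..<?m}. int (lam i))))"
  have "g 0 \<le> n" "n \<le> g ?m"
    using lower[of "{}"] upper[of UNIV] by (simp_all add: g_def n_def lessThan_atLeast0)
  then obtain r where r: "r < ?m" "g r \<le> n" "n \<le> g (Suc r)"
    using interpolating_step[of g n ?m] by auto
  \<comment> \<open>The value that entry \<open>r\<close> must take for the total to be
    \<open>n\<close>; the two inequalities for \<open>g\<close> place it between
    \<open>t * lam r\<close> and \<open>t * M r\<close>.\<close>
  define c where "c = n - int t * ((\<Sum>i<r. int (M i)) + (\<Sum>i\<in>{Suc r..<?m}. int (lam i)))"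
  have "{r..<?m} = insert r {Suc r..<?m}"
    using r by auto
  then have "int t * int (lam r) \<le> c" "c \<le> int t * int (M r)"
    using r by (simp_all add: g_def c_def algebra_simps)
  moreover have anti: "antimono lam"
    using lam by (simp add: partition_at_most_def)
  then have lamM: "lam i \<le> M i" for i
    unfolding M_def by (rule le_row_bound)
  ultimately obtain f where f: "\<And>j. j \<in> {1..t} \<Longrightarrow> int (lam r) \<le> f j \<and> f j \<le> int (M r)"
    and fc: "(\<Sum>j=1..t. f j) = c"
    using split_sum_between[of t "int (lam r)" c "int (M r)"] by auto

  \<comment> \<open>Rows before \<open>r\<close> are as long as possible, rows after
    \<open>r\<close> as short as possible, and row \<open>r\<close> takes the \<open>j\<close>-th
    share of \<open>c\<close>.\<close>
  define \<mu> where "\<mu> = (\<lambda>j i. if i < r then M i else if i = r then nat (f j) else lam i)"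
  have \<mu>A: "\<mu> j \<in> A_set ?m h lam" if "j \<in> {1..t}" for j
  proof (rule A_setI)
    have fj: "lam r \<le> nat (f j)" "nat (f j) \<le> M r"
      using f[OF that] by auto
    have lam_mono: "lam i' \<le> lam i" if "i \<le> i'" for i i'
      using anti that by (simp add: antimono_def)
    have M_mono: "M i' \<le> M i" if "i \<le> i'" for i i'
      unfolding M_def using that by (rule row_bound_antimono)
    have bounds: "lam i \<le> \<mu> j i \<and> \<mu> j i \<le> M i" for i
      using fj lamM by (auto simp: \<mu>_def)
    have "\<mu> j i' \<le> \<mu> j i" if "i \<le> i'" for i i'
    \<comment> \<open>For distinct rows, either the upper one attains its bound \<open>M i\<close>
      or the lower one equals \<open>lam i'\<close>; each suffices.\<close>
    proof (cases "i' < r \<or> i' = r \<and> i < r")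
      case True
      with that have "\<mu> j i = M i \<or> i' = i" by (auto simp: \<mu>_def)
      then show ?thesis
        using bounds[of i'] M_mono[OF that] by auto
    next
      case False
      with that have "\<mu> j i' = lam i' \<or> i' = i" by (auto simp: \<mu>_def)
      then show ?thesis
        using bounds[of i] lam_mono[OF that] by auto
    qed
    then show "partition_at_most ?m (\<mu> j)"
      using lam r by (auto simp: partition_at_most_def antimono_def \<mu>_def)
    show "lam \<le> \<mu> j"
      using bounds by (simp add: le_fun_def)
    show "\<mu> j i \<le> lam i + h * i" for i
      using bounds[of i] row_bound_le[of i i h lam] by (simp add: M_def)
  qed (rule assms(1))
  define \<tau> where "\<tau> = inv_into {..<?m} \<sigma>"
  have \<tau>: "bij_betw \<tau> UNIV {..<?m}"
    unfolding \<tau>_def by (rule bij_betw_inv_into[OF \<sigma>])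
  define q where "q = (\<lambda>k. \<Sum>j\<in>{1..t}. int (\<mu> j (\<tau> k)))"
  have "real_vec (\<lambda>k. int (\<mu> j (\<tau> k))) \<in> convex hull X" if "j \<in> {1..t}" for j
    using \<mu>A[OF that] \<tau> by (intro hull_inc) (auto simp: X_def real_vec_def)
  then have "q \<in> R"
    by (auto simp: R_def q_def intro!: exI[of _ "\<lambda>j k. int (\<mu> j (\<tau> k))"])

  \<comment> \<open>The entries of \<open>q\<close> in the order given by
    \<open>\<sigma>\<close>.\<close>
  define Q where "Q = (\<lambda>i. if i < r then int t * int (M i) else if i = r then c else int t * int (lam i))"
  have q: "q (\<sigma> i) = Q i" if "i < ?m" for i
  proof -
    have "\<tau> (\<sigma> i) = i"
      using \<sigma> that by (simp add: \<tau>_def bij_betw_def)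
    moreover have "(\<Sum>j\<in>{1..t}. int (nat (f j))) = (\<Sum>j\<in>{1..t}. f j)"
      using f by (intro sum.cong) (auto intro: order_trans[of 0 "int (lam r)"])
    ultimately show ?thesis
      using fc by (simp add: q_def Q_def \<mu>_def)
  qed
  have Q: "(\<Sum>i<k. q (\<sigma> i)) = (\<Sum>i<k. Q i)" if "k \<le> ?m" for k
    using that by (intro sum.cong) (auto simp: q)
  have Q_tail: "(\<Sum>i\<in>{k..<?m}. Q i) = int t * (\<Sum>i\<in>{k..<?m}. int (lam i))" if "r < k" for k
    using that by (simp add: sum_distrib_left Q_def)
  have split: "(\<Sum>i<k. Q i) + (\<Sum>i\<in>{k..<?m}. Q i) = (\<Sum>i<?m. Q i)" if "k \<le> ?m" for k
    using that by (simp add: sum.atLeastLessThan_concat lessThan_atLeast0)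
  have Q_head: "(\<Sum>i<k. Q i) = int t * (\<Sum>i<k. int (M i))" if "k \<le> r" for k
    using that by (simp add: sum_distrib_left Q_def)
  have Q_total: "(\<Sum>i<?m. Q i) = n"
    using split[of "Suc r"] r Q_tail[of "Suc r"] Q_head[of r] by (simp add: Q_def c_def algebra_simps)
  have u_head: "(\<Sum>i<k. u (\<sigma> i)) = (\<Sum>k\<in>\<sigma> ` {..<k}. u k)" "card (\<sigma> ` {..<k}) = k" if "k \<le> ?m" for k
    using inj[OF that] by (simp_all add: sum.reindex card_image)
  have u_total: "(\<Sum>i<?m. u (\<sigma> i)) = n"
    using u_head[of ?m] \<sigma> by (simp add: n_def bij_betw_def)
  have "u \<in> R"
  proof (rule transfer_closed_majorized[where p = u and q = q, OF R \<sigma> sorted \<open>q \<in> R\<close>])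
    fix k assume k: "k \<le> ?m"
    show "(\<Sum>i<k. u (\<sigma> i)) \<le> (\<Sum>i<k. q (\<sigma> i))"
    \<comment> \<open>Up to \<open>r\<close> the partial sums of \<open>Q\<close> equal the upper
      bounds for \<open>u\<close>. Beyond \<open>r\<close> the tail of \<open>Q\<close> equals the
      lower bound for the complementary entries of \<open>u\<close>, and equal totals turn this into
      the claim.\<close>
    proof (cases "k \<le> r")
      case True
      then show ?thesis
        using upper[of "\<sigma> ` {..<k}"] by (simp add: Q[OF k] Q_head u_head[OF k])
    next
      case False
      have "(\<Sum>i<k. u (\<sigma> i)) + (\<Sum>k\<in>-\<sigma> ` {..<k}. u k) = n"
        unfolding u_head(1)[OF k] n_def
        by (subst sum.union_disjoint[symmetric]) (auto intro: sum.cong)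
      moreover have "int t * (\<Sum>i\<in>{k..<?m}. int (lam i)) \<le> (\<Sum>k\<in>-\<sigma> ` {..<k}. u k)"
        using lower[of "\<sigma> ` {..<k}"] by (simp add: u_head(2)[OF k])
      ultimately show ?thesis
        using False split[OF k] Q_tail[of k] Q_total by (simp add: Q[OF k])
    qed
  qed (simp_all add: Q Q_total u_total)
  then obtain v where v: "u = (\<lambda>k. \<Sum>j\<in>{1..t}. v j k)"
    "\<forall>j\<in>{1..t}. real_vec (v j) \<in> convex hull X"
    by (auto simp: R_def)
  show "\<exists>v. (\<forall>i\<in>{1..t}. v i \<in> ?P \<inter> lattice_points) \<and> p = (\<Sum>i=1..t. v i)"
  proof (intro exI[of _ "\<lambda>i. real_vec (v i)"] conjI ballI)
    show "real_vec (v i) \<in> ?P \<inter> lattice_points" if "i \<in> {1..t}" for i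
      using v(2) that XP by (auto simp: lattice_points_def real_vec_def)
    show "p = (\<Sum>i=1..t. real_vec (v i))"
      by (simp add: pu v(1) real_vec_def vec_eq_iff)
  qed
qed

end
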